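(* Let $\alpha := \frac14$, $\beta \in (0,1)$ and $c \in (0,\frac58]$, and let $f : \mathbb{R}^{2\times 2} \to \mathbb{R}$ be defined by $$f(X) := \frac{(X_{1,1}-4)^2 + 3(X_{2,2}-2)^2 + (X_{1,2}-X_{2,1})^2}{2}.$$ Consider the minimization of $f$ on $\mathbb{R}^{2\times 2}_{\le 1}$. Starting from $X_0 := \operatorname{diag}(1,0)$ and using $\bar\alpha := \underline{\alpha} := \alpha$, $\beta$ and $c$, the algorithm $\mathrm{P}^2\mathrm{GD}$ produces the sequence $(X_i)_{i\in\mathbb{N}}$ defined by $X_i := \operatorname{diag}(4-3(1-\alpha)^i, 0)$ for every $i \in \mathbb{N}$. In particular, $(X_i)_{i\in\mathbb{N}}$ converges to $\operatorname{diag}(4,0)$, $\lim_{i\to\infty} \mathrm{s}_f(X_i) = 0$, and $\mathrm{s}_f(\operatorname{diag}(4,0)) = 0$.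
   Context: $\mathbb{N}$ includes $0$. $\mathbb{R}^{2\times 2}$ carries the Frobenius inner product and $\|\cdot\|$ is the Frobenius norm; gradients are taken with respect to this inner product. $\mathbb{R}^{2\times 2}_{\le 1} := \{X \in \mathbb{R}^{2\times 2} \mid \operatorname{rank} X \le 1\}$. For a nonempty set $\mathcal{S} \subseteq \mathbb{R}^{2\times 2}$ and $X \in \mathbb{R}^{2\times 2}$, $P_{\mathcal{S}}(X) := \operatorname{argmin}_{Y\in\mathcal{S}} \|X-Y\|$ (a set, identified with its element when it is a singleton). For $X \in \mathcal{S}$, the tangent cone $T_{\mathcal{S}}(X)$ is the set of all $V \in \mathbb{R}^{2\times 2}$ for which there exist $(t_i)_{i\in\mathbb{N}}$ in $(0,\infty)$ converging to $0$ and $(V_i)_{i\in\mathbb{N}}$ in $\mathbb{R}^{2\times 2}$ converging to $V$ such that $X+t_iV_i \in \mathcal{S}$ for every $i$; it is a closed cone, and for a closed cone $\mathcal{C}$ all elements of $P_{\mathcal{C}}(X)$ have the same norm. Stationarity measure: for $X \in \mathbb{R}^{2\times 2}_{\le 1}$, $\mathrm{s}_f(X) := \|P_{T_{\mathbb{R}^{2\times 2}_{\le 1}}(X)}(-\nabla f(X))\|$ (norm of any element of this projection). $\mathrm{P}^2\mathrm{GD}$ map with parameters $0 < \underline{\alpha} \le \bar\alpha < \infty$, $\beta, c \in (0,1)$: given $X \in \mathbb{R}^{2\times 2}_{\le 1}$ with $\mathrm{s}_f(X) > 0$, choose $G \in P_{T_{\mathbb{R}^{2\times 2}_{\le 1}}(X)}(-\nabla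 f(X))$, a step size $\alpha \in [\underline{\alpha},\bar\alpha]$, and $Y \in P_{\mathbb{R}^{2\times 2}_{\le 1}}(X+\alpha G)$; while $f(Y) > f(X) - c\,\alpha\,\mathrm{s}_f(X)^2$, replace $\alpha$ by $\alpha\beta$ and choose a new $Y \in P_{\mathbb{R}^{2\times 2}_{\le 1}}(X+\alpha G)$; then return $Y$. The set of all possible outputs is $\mathrm{P}^2\mathrm{GD}(X; f,\underline{\alpha},\bar\alpha,\beta,c)$. The algorithm $\mathrm{P}^2\mathrm{GD}$ (with stopping tolerance $0$): starting from $X_0 \in \mathbb{R}^{2\times 2}_{\le 1}$, as long as $\mathrm{s}_f(X_i) > 0$, choose $X_{i+1} \in \mathrm{P}^2\mathrm{GD}(X_i; f,\underline{\alpha},\bar\alpha,\beta,c)$. "Produces the sequence $(X_i)$" means that the algorithm never stops and that its iterates are the $X_i$. *)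

theory Defs
  imports "HOL-Analysis.Analysis"
begin

(* The library inner product and norm on real^2^2 are the Frobenius ones, so GDERIV yields
   the gradient with respect to the Frobenius inner product. *)

type_synonym mat2 = "real ^ 2 ^ 2"

definition diag2 :: "real \<Rightarrow> real \<Rightarrow> mat2" where
  "diag2 a b = vector [vector [a, 0], vector [0, b]]"

definition rank_le1 :: "mat2 set" where
  "rank_le1 = {X. rank X \<le> 1}"

definition grad :: "('a::real_inner \<Rightarrow> real) \<Rightarrow> 'a \<Rightarrow> 'a" where
  "grad f X = (THE D. GDERIV f X :> D)"

definition proj :: "'a::real_normed_vector set \<Rightarrow> 'a \<Rightarrow> 'a set" where
  "proj S X = {Y. is_arg_min (\<lambda>Y. norm (X - Y)) (\<lambda>Y. Y \<in> S) Y}"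

definition tangent_cone :: "'a::real_normed_vector set \<Rightarrow> 'a \<Rightarrow> 'a set" where
  "tangent_cone S X = {V. \<exists>(t :: nat \<Rightarrow> real) (W :: nat \<Rightarrow> 'a).
     (\<forall>i. 0 < t i) \<and> t \<longlonglongrightarrow> 0 \<and> W \<longlonglongrightarrow> V \<and> (\<forall>i. X + t i *\<^sub>R W i \<in> S)}"

(* For X in rank_le1 the tangent cone is a closed cone, so the projection is nonempty and its elements
   all have the same norm: the choice made by SOME is immaterial. *)
definition stationarity :: "(mat2 \<Rightarrow> real) \<Rightarrow> mat2 \<Rightarrow> real" where
  "stationarity f X = norm (SOME G. G \<in> proj (tangent_cone rank_le1 X) (- grad f X))"

(* p2gd_search f \<beta> c X G \<alpha> Y Z: the while loop, entered with step size \<alpha> and trial point Y,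
   can end with Y replaced by Z. *)
inductive p2gd_search ::
    "(mat2 \<Rightarrow> real) \<Rightarrow> real \<Rightarrow> real \<Rightarrow> mat2 \<Rightarrow> mat2 \<Rightarrow> real \<Rightarrow> mat2 \<Rightarrow> mat2 \<Rightarrow> bool"
  for f \<beta> c X G where
  accept: "\<not> f Y > f X - c * \<alpha> * (stationarity f X)\<^sup>2 \<Longrightarrow> p2gd_search f \<beta> c X G \<alpha> Y Y"
| backtrack: "f Y > f X - c * \<alpha> * (stationarity f X)\<^sup>2 \<Longrightarrow>
    Y' \<in> proj rank_le1 (X + (\<alpha> * \<beta>) *\<^sub>R G) \<Longrightarrow>
    p2gd_search f \<beta> c X G (\<alpha> * \<beta>) Y' Z \<Longrightarrow> p2gd_search f \<beta> c X G \<alpha> Y Z"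

definition p2gd_map ::
    "(mat2 \<Rightarrow> real) \<Rightarrow> real \<Rightarrow> real \<Rightarrow> real \<Rightarrow> real \<Rightarrow> mat2 \<Rightarrow> mat2 set" where
  "p2gd_map f \<alpha>_min \<alpha>_max \<beta> c X =
     {Z. \<exists>G \<in> proj (tangent_cone rank_le1 X) (- grad f X). \<exists>\<alpha> \<in> {\<alpha>_min..\<alpha>_max}.
         \<exists>Y \<in> proj rank_le1 (X + \<alpha> *\<^sub>R G). p2gd_search f \<beta> c X G \<alpha> Y Z}"

(* p2gd_iterate f \<alpha>_min \<alpha>_max \<beta> c X0 i X: some execution started at X0 has X as its i-th iterate. *)
inductive p2gd_iterate ::
    "(mat2 \<Rightarrow> real) \<Rightarrow> real \<Rightarrow> real \<Rightarrow> real \<Rightarrow> real \<Rightarrow> mat2 \<Rightarrow> nat \<Rightarrow> mat2 \<Rightarrow> bool"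
  for f \<alpha>_min \<alpha>_max \<beta> c X0 where
  start: "p2gd_iterate f \<alpha>_min \<alpha>_max \<beta> c X0 0 X0"
| step: "p2gd_iterate f \<alpha>_min \<alpha>_max \<beta> c X0 i X \<Longrightarrow> stationarity f X > 0 \<Longrightarrow>
    Y \<in> p2gd_map f \<alpha>_min \<alpha>_max \<beta> c X \<Longrightarrow> p2gd_iterate f \<alpha>_min \<alpha>_max \<beta> c X0 (Suc i) Y"

(* The algorithm is nondeterministic: whatever choices are made, it never stops and its
   iterates are the X i. *)
definition p2gd_produces ::
    "(mat2 \<Rightarrow> real) \<Rightarrow> real \<Rightarrow> real \<Rightarrow> real \<Rightarrow> real \<Rightarrow> mat2 \<Rightarrow> (nat \<Rightarrow> mat2) \<Rightarrow> bool" where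
  "p2gd_produces f \<alpha>_min \<alpha>_max \<beta> c X0 X \<longleftrightarrow>
     (\<forall>i. {Y. p2gd_iterate f \<alpha>_min \<alpha>_max \<beta> c X0 i Y} = {X i} \<and> stationarity f (X i) > 0)"

end

theory Submission
  imports Defs
begin

(* On the line of matrices diag x 0 with x nonzero, tangent vectors V of the determinantal variety
   satisfy V_22 = 0, so the component pulling X_22 towards 2 is projected away. Every step is
   then a gradient step of the one-dimensional problem (x - 4)^2 / 2 and stays on that line. It
   decreases f by \<alpha> (1 - \<alpha> / 2) s^2 with 1 - \<alpha> / 2 = 7 / 8 > c, so the line search accepts the
   first trial point. *)

lemma diag2_nth [simp]:
  "diag2 a b $ 1 $ 1 = a" "diag2 a b $ 1 $ 2 = 0" "diag2 a b $ 2 $ 1 = 0" "diag2 a b $ 2 $ 2 = b"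
  by (simp_all add: diag2_def)

lemma mat2_eq_iff:
  fixes A B :: mat2
  shows "A = B \<longleftrightarrow> A $ 1 $ 1 = B $ 1 $ 1 \<and> A $ 1 $ 2 = B $ 1 $ 2 \<and>
    A $ 2 $ 1 = B $ 2 $ 1 \<and> A $ 2 $ 2 = B $ 2 $ 2"
  by (auto simp: vec_eq_iff forall_2)

lemma mat2_inner:
  fixes A B :: mat2
  shows "A \<bullet> B = A $ 1 $ 1 * B $ 1 $ 1 + A $ 1 $ 2 * B $ 1 $ 2 +
    A $ 2 $ 1 * B $ 2 $ 1 + A $ 2 $ 2 * B $ 2 $ 2"
  by (simp add: inner_vec_def sum_2)

lemma diag2_add: "diag2 a b + diag2 a' b' = diag2 (a + a') (b + b')"
  by (simp add: mat2_eq_iff)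

lemma scaleR_diag2: "t *\<^sub>R diag2 a b = diag2 (t * a) (t * b)"
  by (simp add: mat2_eq_iff)

lemma norm_diag2_0: "norm (diag2 a 0) = \<bar>a\<bar>"
  by (simp add: norm_eq_sqrt_inner mat2_inner)

lemma tendsto_diag2:
  assumes "(a \<longlongrightarrow> a') F" "(b \<longlongrightarrow> b') F"
  shows "((\<lambda>i. diag2 (a i) (b i)) \<longlongrightarrow> diag2 a' b') F"
proof -
  have diag2_eq: "diag2 x y = x *\<^sub>R diag2 1 0 + y *\<^sub>R diag2 0 1" for x y
    by (simp add: mat2_eq_iff)
  show ?thesis
    \<comment> \<open>Fixing the first argument keeps the rewriting from looping on
      \<open>diag2 1 0\<close> and \<open>diag2 0 1\<close>.\<close>
    unfolding diag2_eq[of "a _"] diag2_eq[of a'] using assms by (intro tendsto_intros)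
qed

text \<open>For 2 by 2 matrices, rank at most 1 means singular, so membership becomes a single
  polynomial equation in the entries.\<close>

lemma rank_le1_iff: "A \<in> rank_le1 \<longleftrightarrow> A $ 1 $ 1 * A $ 2 $ 2 = A $ 1 $ 2 * A $ 2 $ 1"
  using det_eq_0_rank[of A] by (auto simp: rank_le1_def det_2)

text \<open>Pythagoras for P - V = (P - G) - (V - G) puts every other point of S strictly farther
  from P than G. It serves both the tangent cone and the nonconvex set
  \<open>rank_le1\<close>.\<close>

lemma proj_eq_singleton:
  fixes P :: "'a::real_inner"
  assumes "G \<in> S" and orth: "\<And>V. V \<in> S \<Longrightarrow> (P - G) \<bullet> (V - G) = 0"
  shows "proj S P = {G}"
proof -
  have "(norm (P - V))\<^sup>2 = (norm (P - G))\<^sup>2 + (norm (V - G))\<^sup>2" if "V \<in> S" for V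
  proof -
    have "(norm ((P - G) - (V - G)))\<^sup>2 = (norm (P - G))\<^sup>2 + (norm (V - G))\<^sup>2"
      using orth[OF that] by (simp only: power2_norm_eq_inner inner_diff_left[of "P - G"]
          inner_diff_right[of _ "P - G"] inner_commute[of "V - G" "P - G"])
    then show ?thesis by simp
  qed
  then have "norm (P - G) < norm (P - V)" if "V \<in> S" "V \<noteq> G" for V
    using that by (intro power2_less_imp_less[OF _ norm_ge_zero]) simp
  with \<open>G \<in> S\<close> show ?thesis
    unfolding proj_def is_arg_min_def by (auto dest: less_asym)
qed

lemma grad_eqI:
  assumes "GDERIV f X :> D"
  shows "grad f X = D"
  unfolding grad_def using assms
proof (rule the_equality)
  fix D' assume "GDERIV f X :> D'"
  with assms have "(\<lambda>h. h \<bullet> D') = (\<lambda>h. h \<bullet> D)"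
    unfolding gderiv_def by (rule has_derivative_unique[rotated])
  then show "D' = D"
    by (simp add: fun_eq_iff vector_eq_ldot)
qed

text \<open>Divide the determinant equation of the approximating matrices by t i and let i tend to
  infinity: what remains is x * V_22 = 0.\<close>

lemma tangent_cone_rank_le1_diag2:
  assumes "x \<noteq> 0" "V \<in> tangent_cone rank_le1 (diag2 x 0)"
  shows "V $ 2 $ 2 = 0"
proof -
  obtain t W where t: "\<And>i. 0 < t i" "t \<longlonglongrightarrow> (0::real)" and W: "W \<longlonglongrightarrow> V"
    and mem: "\<And>i. diag2 x 0 + t i *\<^sub>R W i \<in> rank_le1"
    using assms(2) unfolding tangent_cone_def by blast
  have "(x + t i * W i $ 1 $ 1) * W i $ 2 $ 2 = t i * (W i $ 1 $ 2 * W i $ 2 $ 1)" for i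
  proof -
    have "t i * ((x + t i * W i $ 1 $ 1) * W i $ 2 $ 2) =
        t i * (t i * (W i $ 1 $ 2 * W i $ 2 $ 1))"
      using mem[of i] by (simp add: rank_le1_iff algebra_simps)
    then show ?thesis
      using t(1)[of i] by simp
  qed
  moreover have "(\<lambda>i. (x + t i * W i $ 1 $ 1) * W i $ 2 $ 2) \<longlonglongrightarrow> (x + 0 * V $ 1 $ 1) * V $ 2 $ 2"
    by (intro tendsto_intros t W)
  moreover have "(\<lambda>i. t i * (W i $ 1 $ 2 * W i $ 2 $ 1)) \<longlonglongrightarrow> 0 * (V $ 1 $ 2 * V $ 2 $ 1)"
    by (intro tendsto_intros t W)
  ultimately show ?thesis
    using LIMSEQ_unique \<open>x \<noteq> 0\<close> by fastforce
qed

text \<open>The whole line of matrices \<open>diag2 y 0\<close> is singular, so a constant direction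
  along it works with any positive null sequence.\<close>

lemma diag2_0_in_tangent_cone: "diag2 a 0 \<in> tangent_cone rank_le1 (diag2 x 0)"
  unfolding tangent_cone_def
  by (intro CollectI exI[of _ "\<lambda>i. inverse (real (Suc i))"] exI[of _ "\<lambda>_. diag2 a 0"] conjI
      LIMSEQ_inverse_real_of_nat tendsto_const) (auto simp: rank_le1_iff)

text \<open>The residual \<open>diag2 0 b\<close> is orthogonal to every matrix with zero (2,2)
  entry, so the cone need not be computed in full.\<close>

lemma proj_tangent_cone_diag2:
  assumes "x \<noteq> 0"
  shows "proj (tangent_cone rank_le1 (diag2 x 0)) (diag2 a b) = {diag2 a 0}"
  using tangent_cone_rank_le1_diag2[OF assms]
  by (intro proj_eq_singleton diag2_0_in_tangent_cone) (simp add: mat2_inner)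

lemma proj_rank_le1_diag2: "proj rank_le1 (diag2 x 0) = {diag2 x 0}"
  by (intro proj_eq_singleton) (simp_all add: rank_le1_iff)

definition objective :: "mat2 \<Rightarrow> real" where
  "objective A =
    ((A $ 1 $ 1 - 4)\<^sup>2 + 3 * (A $ 2 $ 2 - 2)\<^sup>2 + (A $ 1 $ 2 - A $ 2 $ 1)\<^sup>2) / 2"

text \<open>The entry -6 is 3 * (0 - 2); the off-diagonal terms cancel because both off-diagonal
  entries are 0.\<close>

lemma grad_objective: "grad objective (diag2 x 0) = diag2 (x - 4) (- 6)"
proof (rule grad_eqI)
  have entry: "((\<lambda>A::mat2. A $ i $ j) has_derivative (\<lambda>h. h $ i $ j)) (at B)" for i j B
    by (intro bounded_linear_imp_has_derivative bounded_linear_compose[OF bounded_linear_vec_nth]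
        bounded_linear_vec_nth)
  show "GDERIV objective (diag2 x 0) :> diag2 (x - 4) (- 6)"
    unfolding gderiv_def objective_def
    by (auto intro!: derivative_eq_intros entry[THEN has_derivative_eq_rhs]
        simp: mat2_inner fun_eq_iff field_simps)
qed

lemma proj_grad_objective:
  assumes "x \<noteq> 0"
  shows "proj (tangent_cone rank_le1 (diag2 x 0)) (- grad objective (diag2 x 0)) =
    {diag2 (4 - x) 0}"
proof -
  have "- grad objective (diag2 x 0) = diag2 (4 - x) 6"
    by (simp add: grad_objective mat2_eq_iff)
  then show ?thesis
    using proj_tangent_cone_diag2[OF assms] by simp
qed

lemma stationarity_objective:
  assumes "x \<noteq> 0"
  shows "stationarity objective (diag2 x 0) = \<bar>4 - x\<bar>"
  by (simp add: stationarity_def proj_grad_objective[OF assms] norm_diag2_0)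

text \<open>The guard fails on entry, so only the \<open>accept\<close> rule can apply.\<close>

lemma p2gd_search_accepted:
  assumes "f Y \<le> f X - c * \<alpha> * (stationarity f X)\<^sup>2"
  shows "p2gd_search f \<beta> c X G \<alpha> Y Z \<longleftrightarrow> Z = Y"
  using assms by (subst p2gd_search.simps) auto

lemma p2gd_map_objective:
  assumes "x \<noteq> 0" "0 \<le> \<alpha>" "c \<le> 1 - \<alpha> / 2"
  shows "p2gd_map objective \<alpha> \<alpha> \<beta> c (diag2 x 0) = {diag2 (x + \<alpha> * (4 - x)) 0}"
proof -
  have trial: "proj rank_le1 (diag2 x 0 + \<alpha> *\<^sub>R diag2 (4 - x) 0) = {diag2 (x + \<alpha> * (4 - x)) 0}"
    by (simp add: scaleR_diag2 diag2_add proj_rank_le1_diag2)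
  have "c * (\<alpha> * (4 - x)\<^sup>2) \<le> (1 - \<alpha> / 2) * (\<alpha> * (4 - x)\<^sup>2)"
    using assms by (intro mult_right_mono) auto
  \<comment> \<open>The step multiplies x - 4 by 1 - \<alpha>, and 1 - (1 - \<alpha>)^2 = 2 *
    \<alpha> * (1 - \<alpha> / 2).\<close>
  moreover have "objective (diag2 x 0) - objective (diag2 (x + \<alpha> * (4 - x)) 0) =
      (1 - \<alpha> / 2) * (\<alpha> * (4 - x)\<^sup>2)"
    by (simp add: objective_def field_simps power2_eq_square)
  ultimately have "objective (diag2 (x + \<alpha> * (4 - x)) 0) \<le>
      objective (diag2 x 0) - c * \<alpha> * (stationarity objective (diag2 x 0))\<^sup>2"
    by (simp add: stationarity_objective[OF \<open>x \<noteq> 0\<close>] mult.assoc)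
  then show ?thesis
    unfolding p2gd_map_def proj_grad_objective[OF \<open>x \<noteq> 0\<close>]
    by (simp add: trial p2gd_search_accepted)
qed

text \<open>A single-valued map along X forces every execution to follow X, by induction; positive
  stationarity keeps the \<open>step\<close> rule applicable.\<close>

lemma p2gd_producesI:
  assumes "\<And>i. stationarity f (X i) > 0"
    and "\<And>i. p2gd_map f \<alpha>_min \<alpha>_max \<beta> c (X i) = {X (Suc i)}"
  shows "p2gd_produces f \<alpha>_min \<alpha>_max \<beta> c (X 0) X"
proof -
  have "Y = X i" if "p2gd_iterate f \<alpha>_min \<alpha>_max \<beta> c (X 0) i Y" for i Y
    using that by induction (simp_all add: assms(2))
  moreover have "p2gd_iterate f \<alpha>_min \<alpha>_max \<beta> c (X 0) i (X i)" for i
    by (induction i) (auto intro: p2gd_iterate.intros simp: assms)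
  ultimately show ?thesis
    unfolding p2gd_produces_def using assms(1) by blast
qed

theorem proposition3:
  fixes \<alpha> \<beta> c :: real
    and f :: "real ^ 2 ^ 2 \<Rightarrow> real"
    and X :: "nat \<Rightarrow> real ^ 2 ^ 2"
  assumes "\<alpha> = 1 / 4"
    and "0 < \<beta>" and "\<beta> < 1"
    and "0 < c" and "c \<le> 5 / 8"
    and "\<And>A. f A = ((A $ 1 $ 1 - 4)\<^sup>2 + 3 * (A $ 2 $ 2 - 2)\<^sup>2 + (A $ 1 $ 2 - A $ 2 $ 1)\<^sup>2) / 2"
    and "\<And>i. X i = diag2 (4 - 3 * (1 - \<alpha>) ^ i) 0"
  shows "p2gd_produces f \<alpha> \<alpha> \<beta> c (diag2 1 0) X
    \<and> X \<longlonglongrightarrow> diag2 4 0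
    \<and> (\<lambda>i. stationarity f (X i)) \<longlonglongrightarrow> 0
    \<and> stationarity f (diag2 4 0) = 0"
proof -
  have f: "f = objective"
    using assms(6) by (simp add: fun_eq_iff objective_def)
  have X: "X = (\<lambda>i. diag2 (4 - 3 * (3 / 4) ^ i) 0)"
    unfolding fun_eq_iff assms(7) assms(1) by simp
  \<comment> \<open>The entry is at least 4 - 3 = 1, so the iterates never reach the zero
    matrix.\<close>
  have nz: "4 - 3 * (3 / 4 :: real) ^ i \<noteq> 0" for i
    using power_le_one[of "3 / 4 :: real" i] by simp
  have stat: "stationarity f (X i) = 3 * (3 / 4) ^ i" for i
    unfolding f X by (simp add: stationarity_objective[OF nz])
  \<comment> \<open>The gap 3 * (3/4)^i to 4 shrinks by the factor 1 - 1/4, and c \<le> 5/8 < 7/8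
    gives acceptance.\<close>
  have "p2gd_map f \<alpha> \<alpha> \<beta> c (X i) = {X (Suc i)}" for i
    unfolding f X assms(1) using assms(5)
    by (subst p2gd_map_objective[OF nz]) (simp_all add: field_simps)
  then have "p2gd_produces f \<alpha> \<alpha> \<beta> c (X 0) X"
    by (intro p2gd_producesI) (simp_all add: stat)
  moreover have "X 0 = diag2 1 0"
    by (simp add: X)
  moreover have pow: "(\<lambda>i. 3 * (3 / 4 :: real) ^ i) \<longlonglongrightarrow> 0"
    by (intro tendsto_mult_right_zero LIMSEQ_realpow_zero) auto
  moreover have "X \<longlonglongrightarrow> diag2 4 0"
    unfolding X using tendsto_diff[OF tendsto_const[of 4] pow] by (intro tendsto_diag2) auto
  \<comment> \<open>At \<open>diag2 4 0\<close> the measure is |4 - 4| = 0, although the gradient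
    there is \<open>diag2 0 (- 6)\<close>.\<close>
  ultimately show ?thesis
    unfolding stat by (simp add: f stationarity_objective)
qed

end
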